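(* Let $v\ge1$ and $n=2^v$. The context $\mathbf{K}[v,1]$ has exactly $2n$ prime orbits, namely the following $2n$ sets of minterms $m_s\wedge\bigwedge_{i=0}^{n-1}\Diamond^{\varepsilon_i}m_i$ (with $s$ ranging over $0,\dots,n-1$ in each case): $\mathrm{Vv}_0$: those with $\varepsilon_i=0$ for all $i$; $\mathrm{Dd}_0$: those with $\varepsilon_s=1$ and $\varepsilon_i=0$ for all $i\ne s$; $\mathrm{Dc}_k$ ($1\le k<n$): those with $\varepsilon_s=0$ and exactly $k$ indices $i\ne s$ with $\varepsilon_i=1$; $\mathrm{Dw}_k$ ($1\le k<n$): those with $\varepsilon_s=1$ and exactly $k$ indices $i\ne s$ with $\varepsilon_i=1$. (Each of $\mathrm{Dc}_k,\mathrm{Dw}_k$ thus has $\binom{n-1}{k}$ minterms in each section $s$.)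
   Context: $m_0,\dots,m_{n-1}$ enumerate the $n=2^v$ Boolean minterms $\bigwedge_{k=0}^{v-1}\pm p_k$ in the variables $p_0,\dots,p_{v-1}$. For $\varepsilon_i\in\{0,1\}$, $\Diamond^{1}m_i=\Diamond m_i$ and $\Diamond^{0}m_i=\neg\Diamond m_i$. $\mathbf{K}[v,1]$ is the Lindenbaum–Tarski algebra (modulo provable equivalence in the least normal modal logic $\mathbf{K}$) of formulas in $p_0,\dots,p_{v-1}$ of modal degree $\le1$; its atoms (minterms) are exactly the formulas $m_s\wedge\bigwedge_{i=0}^{n-1}\Diamond^{\varepsilon_i}m_i$, $0\le s<n$, $\varepsilon\in\{0,1\}^n$; $s$ is the section of the minterm. A level-0 substitution is a tuple $(\sigma_0,\dots,\sigma_{v-1})$ of classical propositional formulas in $p_0,\dots,p_{v-1}$ acting by $\varphi\circ\sigma=\varphi(\sigma_0,\dots,\sigma_{v-1})$; under composition $(\sigma\sigma')_i=\sigma_i(\sigma'_0,\dots,\sigma'_{v-1})$ they form a monoid whose invertible elements (prime substitutions) form a group $\mathcal{S}_p(v,0)$, acting on the minterms of $\mathbf{K}[v,1]$ by $\mu\mapsto\mu\circ\varsigma$. The orbits of this action are the prime orbits of $\mathbf{K}[v,1]$. *)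

theory Defs
  imports "HOL-Algebra.Group_Action"
begin

section \<open>Modal formulas and the least normal modal logic\<close>

datatype fm = Var nat | Fls | Imp fm fm | Box fm

abbreviation Neg :: "fm \<Rightarrow> fm" where "Neg A \<equiv> Imp A Fls"
abbreviation Tru :: fm where "Tru \<equiv> Neg Fls"
abbreviation Con :: "fm \<Rightarrow> fm \<Rightarrow> fm" where "Con A B \<equiv> Neg (Imp A (Neg B))"
abbreviation Dis :: "fm \<Rightarrow> fm \<Rightarrow> fm" where "Dis A B \<equiv> Imp (Neg A) B"
abbreviation Dia :: "fm \<Rightarrow> fm" where "Dia A \<equiv> Neg (Box (Neg A))"

definition BigCon :: "fm list \<Rightarrow> fm" where
  "BigCon As = foldr Con As Tru"

primrec vars :: "fm \<Rightarrow> nat set" where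
  "vars (Var k) = {k}"
| "vars Fls = {}"
| "vars (Imp A B) = vars A \<union> vars B"
| "vars (Box A) = vars A"

primrec deg :: "fm \<Rightarrow> nat" where
  "deg (Var k) = 0"
| "deg Fls = 0"
| "deg (Imp A B) = max (deg A) (deg B)"
| "deg (Box A) = Suc (deg A)"

primrec subst :: "(nat \<Rightarrow> fm) \<Rightarrow> fm \<Rightarrow> fm" where
  "subst \<tau> (Var k) = \<tau> k"
| "subst \<tau> Fls = Fls"
| "subst \<tau> (Imp A B) = Imp (subst \<tau> A) (subst \<tau> B)"
| "subst \<tau> (Box A) = Box (subst \<tau> A)"

text \<open>Classical truth value, with variables and boxed formulas valued arbitrarily.\<close>

primrec tval :: "(nat \<Rightarrow> bool) \<Rightarrow> (fm \<Rightarrow> bool) \<Rightarrow> fm \<Rightarrow> bool" where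
  "tval g h (Var k) = g k"
| "tval g h Fls = False"
| "tval g h (Imp A B) = (tval g h A \<longrightarrow> tval g h B)"
| "tval g h (Box A) = h A"

definition tautology :: "fm \<Rightarrow> bool" where
  "tautology A \<longleftrightarrow> (\<forall>g h. tval g h A)"

inductive K_provable :: "fm \<Rightarrow> bool" where
  taut: "tautology A \<Longrightarrow> K_provable A"
| axK: "K_provable (Imp (Box (Imp A B)) (Imp (Box A) (Box B)))"
| MP: "K_provable (Imp A B) \<Longrightarrow> K_provable A \<Longrightarrow> K_provable B"
| Nec: "K_provable A \<Longrightarrow> K_provable (Box A)"
| Subst: "K_provable A \<Longrightarrow> K_provable (subst \<tau> A)"

definition K_equiv :: "fm \<Rightarrow> fm \<Rightarrow> bool" where
  "K_equiv A B \<longleftrightarrow> K_provable (Con (Imp A B) (Imp B A))"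

lemma K_taut1: "K_provable A \<Longrightarrow> tautology (Imp A B) \<Longrightarrow> K_provable B"
  using MP taut by blast

lemma K_taut2:
  "K_provable A \<Longrightarrow> K_provable B \<Longrightarrow> tautology (Imp A (Imp B C)) \<Longrightarrow> K_provable C"
  using MP taut by blast

lemma K_equiv_iff: "K_equiv A B \<longleftrightarrow> K_provable (Imp A B) \<and> K_provable (Imp B A)"
proof
  assume "K_equiv A B"
  then have p: "K_provable (Con (Imp A B) (Imp B A))" by (simp add: K_equiv_def)
  show "K_provable (Imp A B) \<and> K_provable (Imp B A)"
    by (intro conjI; rule K_taut1[OF p]; simp add: tautology_def)
next
  assume "K_provable (Imp A B) \<and> K_provable (Imp B A)"
  then have "K_provable (Imp A B)" "K_provable (Imp B A)" by auto
  then show "K_equiv A B" unfolding K_equiv_def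
    by (rule K_taut2) (simp add: tautology_def)
qed

lemma K_refl: "K_provable (Imp A A)"
  by (rule taut) (simp add: tautology_def)

lemma K_trans: "K_provable (Imp A B) \<Longrightarrow> K_provable (Imp B C) \<Longrightarrow> K_provable (Imp A C)"
  by (erule K_taut2, assumption) (simp add: tautology_def)

lemma K_imp_mono:
  "K_provable (Imp A' A) \<Longrightarrow> K_provable (Imp B B') \<Longrightarrow> K_provable (Imp (Imp A B) (Imp A' B'))"
  by (erule K_taut2, assumption) (simp add: tautology_def)

lemma K_box_mono: "K_provable (Imp A B) \<Longrightarrow> K_provable (Imp (Box A) (Box B))"
  using Nec axK MP by blast

lemma K_equiv_equivp: "equivp K_equiv"
  by (rule equivpI)
    (auto simp: reflp_def symp_def transp_def K_equiv_iff intro: K_refl K_trans)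

lemma K_equiv_Imp: "K_equiv A A' \<Longrightarrow> K_equiv B B' \<Longrightarrow> K_equiv (Imp A B) (Imp A' B')"
  by (auto simp: K_equiv_iff intro: K_imp_mono)

lemma K_equiv_Box: "K_equiv A A' \<Longrightarrow> K_equiv (Box A) (Box A')"
  by (auto simp: K_equiv_iff intro: K_box_mono)

lemma K_equiv_refl: "K_equiv A A"
  by (simp add: K_equiv_iff K_refl)

lemma K_equiv_subst:
  assumes "\<And>k. K_equiv (\<tau> k) (\<tau>' k)" and "K_equiv A B"
  shows "K_equiv (subst \<tau> A) (subst \<tau>' B)"
proof -
  have "K_equiv (subst \<tau> A) (subst \<tau> B)"
    using assms(2) Subst[of "Imp A B" \<tau>] Subst[of "Imp B A" \<tau>] by (simp add: K_equiv_iff)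
  moreover have "K_equiv (subst \<tau> B) (subst \<tau>' B)"
    by (induction B) (simp_all add: assms(1) K_equiv_Imp K_equiv_Box K_equiv_refl)
  ultimately show ?thesis
    using K_equiv_equivp by (meson equivp_transp)
qed

section \<open>The Lindenbaum--Tarski algebra\<close>

quotient_type lindenbaum = fm / K_equiv morphisms rep_lind cls
  by (rule K_equiv_equivp)

instantiation lindenbaum :: boolean_algebra
begin

lift_definition less_eq_lindenbaum :: "lindenbaum \<Rightarrow> lindenbaum \<Rightarrow> bool"
  is "\<lambda>A B. K_provable (Imp A B)"
  by (meson K_equiv_iff K_trans)

definition less_lindenbaum :: "lindenbaum \<Rightarrow> lindenbaum \<Rightarrow> bool" where
  "less_lindenbaum x y \<longleftrightarrow> x \<le> y \<and> \<not> y \<le> x"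

lift_definition bot_lindenbaum :: lindenbaum is Fls .
lift_definition top_lindenbaum :: lindenbaum is Tru .
lift_definition uminus_lindenbaum :: "lindenbaum \<Rightarrow> lindenbaum" is Neg
  by (intro K_equiv_Imp K_equiv_refl)
lift_definition inf_lindenbaum :: "lindenbaum \<Rightarrow> lindenbaum \<Rightarrow> lindenbaum" is Con
  by (intro K_equiv_Imp K_equiv_refl)
lift_definition sup_lindenbaum :: "lindenbaum \<Rightarrow> lindenbaum \<Rightarrow> lindenbaum" is Dis
  by (intro K_equiv_Imp K_equiv_refl)
definition minus_lindenbaum :: "lindenbaum \<Rightarrow> lindenbaum \<Rightarrow> lindenbaum" where
  "minus_lindenbaum x y = inf x (- y)"

instance
proof
  fix x y z :: lindenbaum
  show "(x < y) = (x \<le> y \<and> \<not> y \<le> x)" by (simp add: less_lindenbaum_def)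
  show "x \<le> x" by transfer (rule K_refl)
  show "x \<le> y \<Longrightarrow> y \<le> z \<Longrightarrow> x \<le> z" by transfer (rule K_trans)
  show "x \<le> y \<Longrightarrow> y \<le> x \<Longrightarrow> x = y" by transfer (simp add: K_equiv_iff)
  show "inf x y \<le> x" by transfer (auto intro!: taut simp: tautology_def)
  show "inf x y \<le> y" by transfer (auto intro!: taut simp: tautology_def)
  show "x \<le> y \<Longrightarrow> x \<le> z \<Longrightarrow> x \<le> inf y z"
    by transfer (erule K_taut2, assumption, simp add: tautology_def)
  show "x \<le> sup x y" by transfer (auto intro!: taut simp: tautology_def)
  show "y \<le> sup x y" by transfer (auto intro!: taut simp: tautology_def)
  show "y \<le> x \<Longrightarrow> z \<le> x \<Longrightarrow> sup y z \<le> x"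
    by transfer (erule K_taut2, assumption, auto simp: tautology_def)
  show "bot \<le> x" by transfer (auto intro!: taut simp: tautology_def)
  show "x \<le> Orderings.top" by transfer (auto intro!: taut simp: tautology_def)
  show "sup x (inf y z) = inf (sup x y) (sup x z)"
    by transfer (auto intro!: taut simp: tautology_def K_equiv_iff)
  show "inf x (- x) = bot" by transfer (auto intro!: taut simp: tautology_def K_equiv_iff)
  show "sup x (- x) = Orderings.top" by transfer (auto intro!: taut simp: tautology_def K_equiv_iff)
  show "x - y = inf x (- y)" by (simp add: minus_lindenbaum_def)
qed

end

text \<open>
  The algebra \<open>\<^bold>K[v,d]\<close>, realised inside the algebra of all formulas: the classes having a
  representative in \<open>p\<^sub>0, \<dots>, p\<^sub>v\<^sub>-\<^sub>1\<close> of modal degree at most \<open>d\<close>.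
\<close>

definition K_ctx :: "nat \<Rightarrow> nat \<Rightarrow> lindenbaum set" where
  "K_ctx v d = {cls A | A. vars A \<subseteq> {..<v} \<and> deg A \<le> d}"

definition minterms :: "nat \<Rightarrow> nat \<Rightarrow> lindenbaum set" where
  "minterms v d =
    {\<mu> \<in> K_ctx v d. \<mu> \<noteq> bot \<and> (\<forall>x \<in> K_ctx v d. x \<le> \<mu> \<longrightarrow> x = bot \<or> x = \<mu>)}"

section \<open>Substitutions and prime orbits\<close>

lift_definition lsubst :: "(nat \<Rightarrow> lindenbaum) \<Rightarrow> lindenbaum \<Rightarrow> lindenbaum" is subst
  by (rule K_equiv_subst) (auto simp: rel_fun_def)

text \<open>
  Level-0 substitutions are taken modulo provable equivalence; on literal formulas the only
  invertible tuples would be the permutations of the variables. The tuple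
  \<open>(\<sigma>\<^sub>0, \<dots>, \<sigma>\<^sub>v\<^sub>-\<^sub>1)\<close> is encoded by the total substitution that extends it by \<open>p\<^sub>k\<close> for \<open>k \<ge> v\<close>.
\<close>

definition subst_monoid :: "nat \<Rightarrow> (nat \<Rightarrow> lindenbaum) monoid" where
  "subst_monoid v =
    \<lparr>carrier = {\<sigma>. (\<forall>k<v. \<sigma> k \<in> K_ctx v 0) \<and> (\<forall>k\<ge>v. \<sigma> k = cls (Var k))},
     monoid.mult = (\<lambda>\<sigma> \<sigma>'. \<lambda>i. lsubst \<sigma>' (\<sigma> i)),
     one = (\<lambda>k. cls (Var k))\<rparr>"

definition prime_substs :: "nat \<Rightarrow> (nat \<Rightarrow> lindenbaum) monoid" where
  "prime_substs v = units_of (subst_monoid v)"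

definition prime_orbits :: "nat \<Rightarrow> nat \<Rightarrow> lindenbaum set set" where
  "prime_orbits v d = orbits (prime_substs v) (minterms v d) lsubst"

lemma lsubst_cls: "lsubst (\<lambda>k. cls (\<tau> k)) (cls A) = cls (subst \<tau> A)"
proof -
  have "rel_fun (=) cr_lindenbaum \<tau> (\<lambda>k. cls (\<tau> k))"
    by (auto simp: rel_fun_def cr_lindenbaum_def)
  moreover have "cr_lindenbaum A (cls A)"
    by (simp add: cr_lindenbaum_def)
  ultimately have "cr_lindenbaum (subst \<tau> A) (lsubst (\<lambda>k. cls (\<tau> k)) (cls A))"
    using lsubst.transfer unfolding lindenbaum.pcr_cr_eq by (auto simp: rel_fun_def)
  then show ?thesis by (simp add: cr_lindenbaum_def)
qed

lemma cls_rep: "cls (rep_lind x) = x"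
  by (rule Quotient3_abs_rep[OF Quotient3_lindenbaum])

lemma lsubst_Var: "lsubst \<sigma> (cls (Var k)) = \<sigma> k"
  using lsubst_cls[of "\<lambda>k. rep_lind (\<sigma> k)" "Var k"] by (simp add: cls_rep)

lemma subst_Var: "subst Var A = A"
  by (induction A) auto

lemma subst_subst: "subst \<tau> (subst \<tau>' A) = subst (\<lambda>k. subst \<tau> (\<tau>' k)) A"
  by (induction A) auto

lemma lsubst_id: "lsubst (\<lambda>k. cls (Var k)) x = x"
  using lsubst_cls[of Var "rep_lind x"] by (simp add: cls_rep subst_Var)

lemma lsubst_lsubst: "lsubst \<sigma>' (lsubst \<sigma> x) = lsubst (\<lambda>k. lsubst \<sigma>' (\<sigma> k)) x"
proof -
  define t where "t = (\<lambda>k. rep_lind (\<sigma> k))"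
  define t' where "t' = (\<lambda>k. rep_lind (\<sigma>' k))"
  define A where "A = rep_lind x"
  have eq: "\<sigma> = (\<lambda>k. cls (t k))" "\<sigma>' = (\<lambda>k. cls (t' k))" "x = cls A"
    by (simp_all add: t_def t'_def A_def cls_rep)
  show ?thesis unfolding eq lsubst_cls subst_subst ..
qed

lemma vars_subst: "vars (subst \<tau> A) = (\<Union>k\<in>vars A. vars (\<tau> k))"
  by (induction A) auto

lemma deg_subst: "(\<And>k. k \<in> vars A \<Longrightarrow> deg (\<tau> k) = 0) \<Longrightarrow> deg (subst \<tau> A) = deg A"
  by (induction A) auto

lemma lsubst_K_ctx:
  assumes \<sigma>: "\<sigma> \<in> carrier (subst_monoid v)" and x: "x \<in> K_ctx v d"
  shows "lsubst \<sigma> x \<in> K_ctx v d"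
proof -
  have "\<exists>B. \<sigma> k = cls B \<and> (k < v \<longrightarrow> vars B \<subseteq> {..<v} \<and> deg B = 0)" for k
    using \<sigma> by (cases "k < v") (auto simp: subst_monoid_def K_ctx_def)
  then obtain t where t: "\<And>k. \<sigma> k = cls (t k)"
    "\<And>k. k < v \<Longrightarrow> vars (t k) \<subseteq> {..<v} \<and> deg (t k) = 0"
    by metis
  obtain A where A: "x = cls A" "vars A \<subseteq> {..<v}" "deg A \<le> d"
    using x by (auto simp: K_ctx_def)
  have "\<sigma> = (\<lambda>k. cls (t k))" using t(1) by auto
  then have "lsubst \<sigma> x = cls (subst t A)" by (simp add: A lsubst_cls)
  moreover have "vars (subst t A) \<subseteq> {..<v}" using t(2) A(2) by (fastforce simp: vars_subst)
  moreover have "deg (subst t A) \<le> d" using t(2) A(2,3) by (subst deg_subst) auto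
  ultimately show ?thesis by (auto simp: K_ctx_def)
qed

lemma subst_monoid: "monoid (subst_monoid v)"
proof (rule monoidI)
  show "x \<otimes>\<^bsub>subst_monoid v\<^esub> y \<in> carrier (subst_monoid v)"
    if "x \<in> carrier (subst_monoid v)" "y \<in> carrier (subst_monoid v)" for x y
    using that lsubst_K_ctx[OF that(2)] by (auto simp: subst_monoid_def lsubst_Var)
  show "\<one>\<^bsub>subst_monoid v\<^esub> \<in> carrier (subst_monoid v)"
    by (force simp: subst_monoid_def K_ctx_def)
qed (auto simp: subst_monoid_def lsubst_lsubst lsubst_Var lsubst_id)

lemma prime_substs_group: "group (prime_substs v)"
  unfolding prime_substs_def by (rule monoid.units_group[OF subst_monoid])

section \<open>Explicit minterms\<close>

text \<open>The Boolean minterms \<open>\<And>\<^sub>k\<^sub><\<^sub>v \<plusminus>p\<^sub>k\<close>; \<open>b\<close> gives the signs.\<close>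

definition bool_minterm :: "nat \<Rightarrow> (nat \<Rightarrow> bool) \<Rightarrow> fm" where
  "bool_minterm v b = BigCon (map (\<lambda>k. if b k then Var k else Neg (Var k)) [0..<v])"

definition enumerates_bool_minterms :: "nat \<Rightarrow> (nat \<Rightarrow> fm) \<Rightarrow> bool" where
  "enumerates_bool_minterms v m \<longleftrightarrow> bij_betw m {..<2 ^ v} (range (bool_minterm v))"

definition Dia_sgn :: "bool \<Rightarrow> fm \<Rightarrow> fm" where
  "Dia_sgn e A = (if e then Dia A else Neg (Dia A))"

definition minterm1 :: "nat \<Rightarrow> (nat \<Rightarrow> fm) \<Rightarrow> nat \<Rightarrow> (nat \<Rightarrow> bool) \<Rightarrow> lindenbaum" where
  "minterm1 v m s \<epsilon> = cls (Con (m s) (BigCon (map (\<lambda>i. Dia_sgn (\<epsilon> i) (m i)) [0..<2 ^ v])))"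

definition section_minterms :: "nat \<Rightarrow> (nat \<Rightarrow> fm) \<Rightarrow> nat \<Rightarrow> lindenbaum set" where
  "section_minterms v m s = {minterm1 v m s \<epsilon> | \<epsilon>. True}"

definition Vv0 :: "nat \<Rightarrow> (nat \<Rightarrow> fm) \<Rightarrow> lindenbaum set" where
  "Vv0 v m = {minterm1 v m s \<epsilon> | s \<epsilon>. s < 2 ^ v \<and> (\<forall>i < 2 ^ v. \<not> \<epsilon> i)}"

definition Dd0 :: "nat \<Rightarrow> (nat \<Rightarrow> fm) \<Rightarrow> lindenbaum set" where
  "Dd0 v m = {minterm1 v m s \<epsilon> | s \<epsilon>. s < 2 ^ v \<and> \<epsilon> s \<and> (\<forall>i < 2 ^ v. i \<noteq> s \<longrightarrow> \<not> \<epsilon> i)}"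

definition Dc :: "nat \<Rightarrow> (nat \<Rightarrow> fm) \<Rightarrow> nat \<Rightarrow> lindenbaum set" where
  "Dc v m k = {minterm1 v m s \<epsilon> | s \<epsilon>.
     s < 2 ^ v \<and> \<not> \<epsilon> s \<and> card {i. i < 2 ^ v \<and> i \<noteq> s \<and> \<epsilon> i} = k}"

definition Dw :: "nat \<Rightarrow> (nat \<Rightarrow> fm) \<Rightarrow> nat \<Rightarrow> lindenbaum set" where
  "Dw v m k = {minterm1 v m s \<epsilon> | s \<epsilon>.
     s < 2 ^ v \<and> \<epsilon> s \<and> card {i. i < 2 ^ v \<and> i \<noteq> s \<and> \<epsilon> i} = k}"

end

theory Submission
  imports Defs "HOL-Combinatorics.Permutations"
begin

text \<open>
  Provability in \<open>\<^bold>K\<close> of a formula of modal degree at most one means truth at the roots of all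
  Kripke models of height at most one. Up to the values of the variables beyond \<open>p\<^sub>v\<^sub>-\<^sub>1\<close>, such a
  model is a pair \<open>(s, E)\<close>, where \<open>s < n\<close> is the index of the Boolean minterm true at the root and
  \<open>E \<subseteq> {0, \<dots>, n - 1}\<close> is the set of indices realised at its successors; so these pairs
  correspond to the minterms of \<open>\<^bold>K[v,1]\<close>. A level-0 substitution pulls valuations back and thus
  induces a self-map of the indices. This identifies the substitutions with all self-maps and the
  prime ones with the permutations, which act on both components of a pair. Two pairs lie in the
  same orbit iff they agree on whether \<open>s \<in> E\<close> and on the cardinality of \<open>E - {s}\<close>.
\<close>

section \<open>Pointed subsets up to permutation\<close>

definition pointed_card :: "'a \<Rightarrow> 'a set \<Rightarrow> bool \<times> nat" where
  "pointed_card s E = (s \<in> E, card (E - {s}))"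

lemma pointed_card_image:
  assumes "inj f"
  shows "pointed_card (f s) (f ` E) = pointed_card s E"
proof -
  have "f ` E - {f s} = f ` (E - {s})"
    using image_set_diff[OF assms, of E "{s}"] by simp
  then show ?thesis
    using card_image[OF inj_on_subset[OF assms subset_UNIV], of "E - {s}"]
    by (simp add: pointed_card_def inj_image_mem_iff[OF assms])
qed

lemma image_mset_pointed_set:
  assumes "finite A" "s \<in> A" "E \<subseteq> A"
  shows "image_mset (\<lambda>i. (i = s, i \<in> E)) (mset_set A) =
    add_mset (True, s \<in> E)
      (replicate_mset (card (E - {s})) (False, True)
        + replicate_mset (card A - 1 - card (E - {s})) (False, False))"
proof -
  let ?f = "\<lambda>i. (i = s, i \<in> E)" and ?in = "E - {s}" and ?out = "A - {s} - (E - {s})"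
  have fin: "finite ?in" "finite ?out" using assms finite_subset by blast+
  have "A = insert s (?in \<union> ?out)" using assms by blast
  then have "mset_set A = mset_set (insert s (?in \<union> ?out))" by simp
  also have "\<dots> = add_mset s (mset_set (?in \<union> ?out))" using fin by simp
  also have "mset_set (?in \<union> ?out) = mset_set ?in + mset_set ?out"
    using fin by (intro mset_set_Union) auto
  finally have "image_mset ?f (mset_set A) =
      add_mset (?f s) (image_mset ?f (mset_set ?in) + image_mset ?f (mset_set ?out))"
    by simp
  moreover have "image_mset ?f (mset_set ?in) = image_mset (\<lambda>_. (False, True)) (mset_set ?in)"
    using fin by (intro image_mset_cong) auto
  moreover have "image_mset ?f (mset_set ?out) = image_mset (\<lambda>_. (False, False)) (mset_set ?out)"
    using fin by (intro image_mset_cong) auto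
  moreover have "card ?out = card A - 1 - card ?in"
    using assms fin by (subst card_Diff_subset) auto
  ultimately show ?thesis by (simp add: image_mset_const_eq)
qed

lemma ex_permutes_pointed_iff:
  assumes A: "finite A" and "s \<in> A" "E \<subseteq> A" "s' \<in> A" "E' \<subseteq> A"
  shows "(\<exists>\<pi>. \<pi> permutes A \<and> \<pi> s = s' \<and> \<pi> ` E = E') \<longleftrightarrow> pointed_card s E = pointed_card s' E'"
proof
  assume "\<exists>\<pi>. \<pi> permutes A \<and> \<pi> s = s' \<and> \<pi> ` E = E'"
  then show "pointed_card s E = pointed_card s' E'"
    using pointed_card_image permutes_inj by metis
next
  assume "pointed_card s E = pointed_card s' E'"
  then have "image_mset (\<lambda>i. (i = s, i \<in> E)) (mset_set A)
      = image_mset (\<lambda>i. (i = s', i \<in> E')) (mset_set A)"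
    using assms by (simp add: image_mset_pointed_set pointed_card_def)
  then obtain \<pi> where \<pi>: "\<pi> permutes A"
    and eq: "\<forall>i\<in>A. (i = s, i \<in> E) = (\<pi> i = s', \<pi> i \<in> E')"
    by (rule image_mset_eq_implies_permutes[OF A])
  have "E = \<pi> -` E'"
    using eq assms permutes_in_image[OF \<pi>] by blast
  then have "\<pi> ` E = E'" using permutes_surj[OF \<pi>] by (simp add: surj_image_vimage_eq)
  moreover have "\<pi> s = s'" using eq \<open>s \<in> A\<close> by auto
  ultimately show "\<exists>\<pi>. \<pi> permutes A \<and> \<pi> s = s' \<and> \<pi> ` E = E'" using \<pi> by blast
qed

lemma card_subsets_pointed_card:
  assumes "finite A" "s \<in> A"
  shows "card {E. E \<subseteq> A \<and> pointed_card s E = (e, k)} = (card A - 1) choose k"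
proof -
  let ?extend = "\<lambda>B. if e then insert s B else B"
  have "bij_betw ?extend {B. B \<subseteq> A - {s} \<and> card B = k}
      {E. E \<subseteq> A \<and> pointed_card s E = (e, k)}" (is "bij_betw _ ?Bs ?Es")
  proof (rule bij_betw_byWitness[where f' = "\<lambda>E. E - {s}"])
    show restrict_extend: "\<forall>B\<in>?Bs. ?extend B - {s} = B" by auto
    show "\<forall>E\<in>?Es. ?extend (E - {s}) = E" by (auto simp: pointed_card_def)
    show "?extend ` ?Bs \<subseteq> ?Es"
    proof (rule image_subsetI)
      fix B assume B: "B \<in> ?Bs"
      then have "s \<in> ?extend B \<longleftrightarrow> e" "?extend B \<subseteq> A" using \<open>s \<in> A\<close> by auto
      then show "?extend B \<in> ?Es" using B restrict_extend by (simp add: pointed_card_def)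
    qed
    show "(\<lambda>E. E - {s}) ` ?Es \<subseteq> ?Bs" by (auto simp: pointed_card_def)
  qed
  then have "card ?Es = card ?Bs" by (rule bij_betw_same_card[symmetric])
  also have "\<dots> = (card A - 1) choose k" using assms by (simp add: n_subsets)
  finally show ?thesis .
qed

section \<open>Completeness of \<open>\<^bold>K\<close> in modal degree one\<close>

lemma tval_foldr_Imp:
  "tval g h (foldr Imp As B) \<longleftrightarrow> ((\<forall>A\<in>set As. tval g h A) \<longrightarrow> tval g h B)"
  by (induction As) auto

lemma K_foldr_MP:
  "K_provable (foldr Imp As B) \<Longrightarrow> (\<And>A. A \<in> set As \<Longrightarrow> K_provable A) \<Longrightarrow> K_provable B"
proof (induction As)
  case (Cons A As)
  then have "K_provable (Imp A (foldr Imp As B))" "K_provable A" by simp_all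
  then have "K_provable (foldr Imp As B)" by (rule MP)
  then show ?case using Cons by simp
qed simp

lemma K_Box_foldr_Imp:
  "K_provable (Imp (Box (foldr Imp As B)) (foldr Imp (map Box As) (Box B)))"
proof (induction As)
  case Nil
  show ?case by (simp add: K_refl)
next
  case (Cons A As)
  show ?case
    by (rule K_taut2[OF axK[of A "foldr Imp As B"] Cons.IH]) (simp add: tautology_def)
qed

lemma K_Box_entailment:
  assumes "\<And>g h. (\<And>A. A \<in> set As \<Longrightarrow> tval g h A) \<Longrightarrow> tval g h B"
  shows "K_provable (foldr Imp (map Box As) (Box B))"
proof -
  have "tautology (foldr Imp As B)" using assms by (auto simp: tautology_def tval_foldr_Imp)
  then have "K_provable (Box (foldr Imp As B))" by (intro Nec taut)
  then show ?thesis by (rule MP[OF K_Box_foldr_Imp])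
qed

lemma ex_falsifying_tval:
  assumes "\<not> K_provable A" "finite \<Gamma>"
  obtains g h where "\<not> tval g h A" "\<And>B. B \<in> \<Gamma> \<Longrightarrow> K_provable B \<Longrightarrow> tval g h B"
proof -
  obtain Bs where Bs: "set Bs = {B \<in> \<Gamma>. K_provable B}"
    using finite_list[of "{B \<in> \<Gamma>. K_provable B}"] assms(2) by auto
  have "\<not> tautology (foldr Imp Bs A)"
    using K_foldr_MP[of Bs A] taut Bs assms(1) by blast
  then show ?thesis
    using that Bs by (auto simp: tautology_def tval_foldr_Imp)
qed

primrec boxed :: "fm \<Rightarrow> fm set" where
  "boxed (Var k) = {}"
| "boxed Fls = {}"
| "boxed (Imp A B) = boxed A \<union> boxed B"
| "boxed (Box A) = {A}"

lemma finite_boxed: "finite (boxed A)"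
  by (induction A) auto

lemma deg_boxed: "B \<in> boxed A \<Longrightarrow> deg B < deg A"
  by (induction A) auto

lemma tval_cong_boxed:
  "(\<And>B. B \<in> boxed A \<Longrightarrow> h B = h' B) \<Longrightarrow> tval g h A = tval g h' A"
  by (induction A) auto

text \<open>
  Truth at the root of a Kripke model of height at most one: the root has valuation \<open>g\<close> and its
  successors are dead ends, one for each valuation in \<open>X\<close>.
\<close>

primrec sat :: "(nat \<Rightarrow> bool) set \<Rightarrow> (nat \<Rightarrow> bool) \<Rightarrow> fm \<Rightarrow> bool" where
  "sat X g (Var k) = g k"
| "sat X g Fls = False"
| "sat X g (Imp A B) = (sat X g A \<longrightarrow> sat X g B)"
| "sat X g (Box A) = (\<forall>u\<in>X. sat {} u A)"

lemma sat_tval: "sat X g A = tval g (\<lambda>B. \<forall>u\<in>X. sat {} u B) A"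
  by (induction A) auto

lemma sat_subst:
  "sat X g (subst \<tau> A) = sat ((\<lambda>u k. sat {} u (\<tau> k)) ` X) (\<lambda>k. sat X g (\<tau> k)) A"
  by (induction A arbitrary: X g) auto

lemma sat_image_cong:
  "(\<And>u k. k \<in> vars A \<Longrightarrow> f u k = u k) \<Longrightarrow> sat (f ` X) (f g) A = sat X g A"
proof (induction A arbitrary: X g)
  case (Box A)
  have "sat {} (f u) A = sat {} u A" for u
    using Box.IH[of "{}" u] Box.prems by simp
  then show ?case by simp
qed auto

lemma sat_deg_0: "deg A = 0 \<Longrightarrow> sat X g A = tval g h A"
  by (induction A) auto

theorem K_sound: "K_provable A \<Longrightarrow> sat X g A"
proof (induction arbitrary: X g rule: K_provable.induct)
  case (taut A)
  then show ?case by (subst sat_tval) (simp add: tautology_def)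
qed (auto simp: sat_subst)

lemma sat_mono: "K_provable (Imp A B) \<Longrightarrow> sat X g A \<Longrightarrow> sat X g B"
  using K_sound[of "Imp A B" X g] by simp

theorem K_complete_deg_1:
  assumes "deg A \<le> 1" and valid: "\<And>X g. sat X g A"
  shows "K_provable A"
proof (rule ccontr)
  assume unprovable: "\<not> K_provable A"
  obtain Cs where Cs: "set Cs = boxed A" using finite_list[OF finite_boxed] by blast
  let ?\<Gamma> = "(\<lambda>(Bs, C). foldr Imp (map Box Bs) (Box C)) ` (set (subseqs Cs) \<times> boxed A)"
  obtain g h where "\<not> tval g h A" and tval_\<Gamma>: "\<And>B. B \<in> ?\<Gamma> \<Longrightarrow> K_provable B \<Longrightarrow> tval g h B"
    using ex_falsifying_tval[OF unprovable, of ?\<Gamma>] finite_boxed by auto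
  txt \<open>As \<open>?\<Gamma>\<close> makes \<open>h\<close> respect all entailments between boxed subformulas, \<open>h\<close> is realised by
    the following set of successors.\<close>
  define X where "X = {u. \<forall>B\<in>boxed A. h B \<longrightarrow> sat {} u B}"
  have h_boxed_iff: "h C \<longleftrightarrow> (\<forall>u\<in>X. sat {} u C)" if C: "C \<in> boxed A" for C
  proof
    assume "h C"
    then show "\<forall>u\<in>X. sat {} u C" using C by (simp add: X_def)
  next
    assume X_C: "\<forall>u\<in>X. sat {} u C"
    have "{B \<in> boxed A. h B} \<in> set ` set (subseqs Cs)"
      unfolding subseqs_powset Cs by blast
    then obtain Bs where Bs: "Bs \<in> set (subseqs Cs)" "set Bs = {B \<in> boxed A. h B}" by auto
    have "deg B = 0" if "B \<in> boxed A" for B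
      using deg_boxed[OF that] assms(1) by simp
    then have "tval u h' B = sat {} u B" if "B \<in> boxed A" for u h' B
      using sat_deg_0 that by metis
    then have "tval u h' C" if "\<And>B. B \<in> set Bs \<Longrightarrow> tval u h' B" for u h'
      using that X_C C Bs(2) by (simp add: X_def)
    then have "K_provable (foldr Imp (map Box Bs) (Box C))" by (rule K_Box_entailment)
    then have "tval g h (foldr Imp (map Box Bs) (Box C))" using tval_\<Gamma> Bs(1) C by blast
    then show "h C" using Bs(2) by (auto simp: tval_foldr_Imp)
  qed
  have "tval g h A = tval g (\<lambda>B. \<forall>u\<in>X. sat {} u B) A"
    using h_boxed_iff by (rule tval_cong_boxed)
  then show False
    using \<open>\<not> tval g h A\<close> valid[of X g] by (simp add: sat_tval[of X g A])
qed

section \<open>Truth of elements of the Lindenbaum--Tarski algebra\<close>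

lift_definition holds :: "(nat \<Rightarrow> bool) set \<Rightarrow> (nat \<Rightarrow> bool) \<Rightarrow> lindenbaum \<Rightarrow> bool" is sat
  by (auto simp: K_equiv_iff fun_eq_iff intro: sat_mono)

lemma holds_cls_Var [simp]: "holds X g (cls (Var k)) = g k"
  by (simp add: holds.abs_eq)

lemma holds_bot [simp]: "\<not> holds X g bot"
  by transfer simp

lemma holds_mono: "x \<le> y \<Longrightarrow> holds X g x \<Longrightarrow> holds X g y"
  by transfer (rule sat_mono)

lemma holds_lsubst:
  "holds X g (lsubst \<sigma> x) = holds ((\<lambda>u k. holds {} u (\<sigma> k)) ` X) (\<lambda>k. holds X g (\<sigma> k)) x"
  by transfer (rule sat_subst)

lemma K_ctx_mono: "d \<le> d' \<Longrightarrow> K_ctx v d \<subseteq> K_ctx v d'"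
  by (auto simp: K_ctx_def)

lemma holds_K_ctx_0: "x \<in> K_ctx v 0 \<Longrightarrow> holds X g x = holds X' g x"
  by (auto simp: K_ctx_def holds.abs_eq sat_deg_0[where h = "\<lambda>_. True"])

lemma holds_image_cong:
  assumes "x \<in> K_ctx v d" "\<And>u k. k < v \<Longrightarrow> f u k = u k"
  shows "holds (f ` X) (f g) x = holds X g x"
proof -
  obtain A where "x = cls A" "vars A \<subseteq> {..<v}" using assms(1) by (auto simp: K_ctx_def)
  then show ?thesis using assms(2) by (auto simp: holds.abs_eq intro!: sat_image_cong)
qed

lemma K_ctx_1_leI:
  assumes "x \<in> K_ctx v 1" "y \<in> K_ctx v 1" "\<And>X g. holds X g x \<Longrightarrow> holds X g y"
  shows "x \<le> y"
proof -
  obtain A B where AB: "x = cls A" "deg A \<le> 1" "y = cls B" "deg B \<le> 1"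
    using assms(1,2) by (auto simp: K_ctx_def)
  have "K_provable (Imp A B)"
    using AB assms(3) by (intro K_complete_deg_1) (auto simp: holds.abs_eq)
  then show ?thesis by (simp add: AB less_eq_lindenbaum.abs_eq)
qed

lemma K_ctx_1_eqI:
  assumes "x \<in> K_ctx v 1" "y \<in> K_ctx v 1" "\<And>X g. holds X g x = holds X g y"
  shows "x = y"
  using assms by (intro antisym K_ctx_1_leI) auto

lemma bot_in_K_ctx: "bot \<in> K_ctx v d"
  by (force simp: K_ctx_def bot_lindenbaum.abs_eq)

lemma ex_holds_if_ne_bot:
  assumes "x \<in> K_ctx v 1" "x \<noteq> bot"
  obtains X g where "holds X g x"
  using K_ctx_1_eqI[OF assms(1) bot_in_K_ctx] assms(2) holds_bot by blast

section \<open>Boolean minterms and their indices\<close>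

lemma sat_BigCon [simp]: "sat X g (BigCon As) \<longleftrightarrow> (\<forall>A\<in>set As. sat X g A)"
  unfolding BigCon_def by (induction As) auto

lemma vars_BigCon [simp]: "vars (BigCon As) = (\<Union>A\<in>set As. vars A)"
  unfolding BigCon_def by (induction As) auto

lemma deg_BigCon_le: "(\<And>A. A \<in> set As \<Longrightarrow> deg A \<le> d) \<Longrightarrow> deg (BigCon As) \<le> d"
  unfolding BigCon_def by (induction As) auto

lemma sat_bool_minterm: "sat X g (bool_minterm v b) \<longleftrightarrow> (\<forall>k<v. g k = b k)"
  by (auto simp: bool_minterm_def ball_Un)

lemma vars_bool_minterm: "vars (bool_minterm v b) \<subseteq> {..<v}"
  by (auto simp: bool_minterm_def split: if_splits)

lemma deg_bool_minterm: "deg (bool_minterm v b) = 0"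
proof -
  have "deg (bool_minterm v b) \<le> 0" unfolding bool_minterm_def by (rule deg_BigCon_le) auto
  then show ?thesis by simp
qed

locale bool_minterm_enumeration =
  fixes v :: nat and m :: "nat \<Rightarrow> fm"
  assumes enum: "enumerates_bool_minterms v m"
begin

abbreviation n :: nat where "n \<equiv> 2 ^ v"

definition index :: "(nat \<Rightarrow> bool) \<Rightarrow> nat" where
  "index g = inv_into {..<n} m (bool_minterm v g)"

definition valuation :: "nat \<Rightarrow> nat \<Rightarrow> bool" where
  "valuation i = (SOME g. index g = i)"

lemma bij_m: "bij_betw m {..<n} (range (bool_minterm v))"
  using enum by (simp add: enumerates_bool_minterms_def)

lemma index_less [simp]: "index g < n"
  using bij_m unfolding index_def by (metis bij_betw_def inv_into_into lessThan_iff rangeI)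

lemma m_index: "m (index g) = bool_minterm v g"
  using bij_m unfolding index_def by (metis bij_betw_def f_inv_into_f rangeI)

lemma ex_index_eq:
  assumes "i < n"
  obtains g where "index g = i"
proof -
  obtain g where m_i: "bool_minterm v g = m i"
    using bij_betw_apply[OF bij_m, of i] assms by auto
  have "index g = i"
    unfolding index_def m_i using assms by (simp add: bij_betw_imp_inj_on[OF bij_m])
  then show ?thesis by (rule that)
qed

lemma index_valuation [simp]: "i < n \<Longrightarrow> index (valuation i) = i"
  unfolding valuation_def using ex_index_eq by (metis (mono_tags) someI)

lemma index_eq_iff: "index g = index g' \<longleftrightarrow> (\<forall>k<v. g k = g' k)"
proof
  assume "index g = index g'"
  then have "bool_minterm v g = bool_minterm v g'" by (metis m_index)
  then show "\<forall>k<v. g k = g' k" using sat_bool_minterm by metis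
next
  assume "\<forall>k<v. g k = g' k"
  then have "bool_minterm v g = bool_minterm v g'"
    unfolding bool_minterm_def by (intro arg_cong[of _ _ BigCon]) auto
  then show "index g = index g'" by (simp add: index_def)
qed

lemma valuation_index: "k < v \<Longrightarrow> valuation (index g) k = g k"
  using index_eq_iff[of "valuation (index g)" g] by simp

lemma m_eq_bool_minterm: "i < n \<Longrightarrow> m i = bool_minterm v (valuation i)"
  using m_index[of "valuation i"] by simp

lemma sat_m: "i < n \<Longrightarrow> sat X g (m i) \<longleftrightarrow> index g = i"
  using index_eq_iff[of g "valuation i"] by (simp add: m_eq_bool_minterm sat_bool_minterm)

lemma vars_m: "i < n \<Longrightarrow> vars (m i) \<subseteq> {..<v}"
  by (simp add: m_eq_bool_minterm vars_bool_minterm)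

lemma deg_m: "i < n \<Longrightarrow> deg (m i) = 0"
  by (simp add: m_eq_bool_minterm deg_bool_minterm)

lemma holds_valuation_index:
  "x \<in> K_ctx v d \<Longrightarrow> holds (valuation ` index ` X) (valuation (index g)) x = holds X g x"
  using holds_image_cong[of x v d "\<lambda>u. valuation (index u)"]
  by (simp add: image_image valuation_index)

lemma ex_truth_function:
  "\<exists>x \<in> K_ctx v 0. \<forall>X g. holds X g x = F (index g)"
proof (intro bexI allI)
  let ?Ms = "map (\<lambda>i. Neg (m i)) (filter F [0..<n])"
  have "deg (BigCon ?Ms) \<le> 0" by (rule deg_BigCon_le) (auto simp: deg_m)
  moreover have "vars (BigCon ?Ms) \<subseteq> {..<v}" using vars_m by auto
  ultimately show "cls (Neg (BigCon ?Ms)) \<in> K_ctx v 0" by (fastforce simp: K_ctx_def)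
  fix X g
  show "holds X g (cls (Neg (BigCon ?Ms))) = F (index g)"
    by (auto simp: holds.abs_eq sat_m)
qed

section \<open>The minterms of \<open>\<^bold>K[v,1]\<close>\<close>

definition minterm :: "nat \<Rightarrow> nat set \<Rightarrow> lindenbaum" where
  "minterm s E = minterm1 v m s (\<lambda>i. i \<in> E)"

lemma minterm1_eq_minterm: "minterm1 v m s \<epsilon> = minterm s {i. i < n \<and> \<epsilon> i}"
  unfolding minterm_def minterm1_def
  by (intro arg_cong[of _ _ "\<lambda>As. cls (Con (m s) (BigCon As))"] map_cong) auto

lemma holds_minterm:
  assumes "s < n" "E \<subseteq> {..<n}"
  shows "holds X g (minterm s E) \<longleftrightarrow> index g = s \<and> index ` X = E"
proof -
  have "holds X g (minterm s E) \<longleftrightarrow> index g = s \<and> (\<forall>i<n. i \<in> E \<longleftrightarrow> (\<exists>u\<in>X. index u = i))"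
    using assms(1)
    by (auto simp: minterm_def minterm1_def holds.abs_eq Dia_sgn_def sat_m ball_Un)
  also have "(\<forall>i<n. i \<in> E \<longleftrightarrow> (\<exists>u\<in>X. index u = i)) \<longleftrightarrow> index ` X = E"
    using assms(2) index_less by blast
  finally show ?thesis .
qed

lemma holds_minterm_valuation:
  assumes "s < n" "E \<subseteq> {..<n}"
  shows "holds (valuation ` E) (valuation s) (minterm s E)"
proof -
  have "index ` valuation ` E = E" using assms(2) by (force simp: image_image)
  then show ?thesis using assms by (simp add: holds_minterm)
qed

lemma minterm_eq_iff:
  assumes "s < n" "E \<subseteq> {..<n}" "s' < n" "E' \<subseteq> {..<n}"
  shows "minterm s E = minterm s' E' \<longleftrightarrow> s = s' \<and> E = E'"
  using assms holds_minterm_valuation holds_minterm by metis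

lemma minterm_ne_bot:
  assumes "s < n" "E \<subseteq> {..<n}"
  shows "minterm s E \<noteq> bot"
  using holds_minterm_valuation[OF assms] by auto

lemma minterm_in_K_ctx:
  assumes "s < n"
  shows "minterm s E \<in> K_ctx v 1"
proof -
  let ?Ds = "map (\<lambda>i. Dia_sgn (i \<in> E) (m i)) [0..<n]"
  let ?A = "Con (m s) (BigCon ?Ds)"
  have "deg (BigCon ?Ds) \<le> 1"
    by (rule deg_BigCon_le) (auto simp: Dia_sgn_def deg_m)
  then have "deg ?A \<le> 1" using assms by (simp add: deg_m)
  moreover have "vars ?A \<subseteq> {..<v}"
    using assms vars_m by (fastforce simp: Dia_sgn_def split: if_splits)
  ultimately have "cls ?A \<in> K_ctx v 1" unfolding K_ctx_def by blast
  then show ?thesis by (simp add: minterm_def minterm1_def)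
qed

lemma minterm_le_if_holds:
  assumes "x \<in> K_ctx v 1" "holds X g x"
  shows "minterm (index g) (index ` X) \<le> x"
proof (rule K_ctx_1_leI[OF minterm_in_K_ctx assms(1)])
  fix X' g' assume "holds X' g' (minterm (index g) (index ` X))"
  then have "index g' = index g" "index ` X' = index ` X"
    by (auto simp: holds_minterm image_subset_iff)
  then show "holds X' g' x"
    using assms(2) holds_valuation_index[OF assms(1)] by metis
qed simp

lemma minterms_eq: "minterms v 1 = {minterm s E | s E. s < n \<and> E \<subseteq> {..<n}}"
proof (intro subset_antisym subsetI)
  fix x assume x: "x \<in> minterms v 1"
  then have ctx: "x \<in> K_ctx v 1" "x \<noteq> bot" by (auto simp: minterms_def)
  then obtain X g where "holds X g x" by (rule ex_holds_if_ne_bot)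
  then have "minterm (index g) (index ` X) \<le> x" by (rule minterm_le_if_holds[OF ctx(1)])
  moreover have index: "index g < n" "index ` X \<subseteq> {..<n}" by auto
  ultimately have "x = minterm (index g) (index ` X)"
    using x minterm_in_K_ctx[OF index(1)] minterm_ne_bot[OF index] by (auto simp: minterms_def)
  then show "x \<in> {minterm s E | s E. s < n \<and> E \<subseteq> {..<n}}" using index by blast
next
  fix x assume "x \<in> {minterm s E | s E. s < n \<and> E \<subseteq> {..<n}}"
  then obtain s E where bounds: "s < n" "E \<subseteq> {..<n}" and x: "x = minterm s E" by auto
  have "y = x" if y: "y \<in> K_ctx v 1" "y \<le> x" "y \<noteq> bot" for y
  proof -
    obtain X g where g: "holds X g y" using y(1,3) by (rule ex_holds_if_ne_bot)
    then have "holds X g (minterm s E)" using y(2) x holds_mono by blast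
    then have "minterm s E \<le> y"
      using minterm_le_if_holds[OF y(1) g] bounds by (simp add: holds_minterm)
    then show ?thesis using y(2) x by simp
  qed
  then show "x \<in> minterms v 1"
    using bounds minterm_in_K_ctx minterm_ne_bot unfolding minterms_def x by blast
qed

section \<open>Prime substitutions as permutations\<close>

definition index_map :: "(nat \<Rightarrow> lindenbaum) \<Rightarrow> nat \<Rightarrow> nat" where
  "index_map \<sigma> i = (if i < n then index (\<lambda>k. holds {} (valuation i) (\<sigma> k)) else i)"

lemma index_holds_subst:
  assumes "\<sigma> \<in> carrier (subst_monoid v)"
  shows "index (\<lambda>k. holds X g (\<sigma> k)) = index_map \<sigma> (index g)"
proof -
  have "holds X g (\<sigma> k) = holds {} (valuation (index g)) (\<sigma> k)" if "k < v" for k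
  proof -
    have \<sigma>_k: "\<sigma> k \<in> K_ctx v 0" using assms that by (simp add: subst_monoid_def)
    show ?thesis
      using holds_valuation_index[OF \<sigma>_k, of "{}" g] holds_K_ctx_0[OF \<sigma>_k, of X g "{}"] by simp
  qed
  then show ?thesis by (simp add: index_map_def index_eq_iff)
qed

lemma index_map_mult:
  assumes "\<sigma> \<in> carrier (subst_monoid v)" "\<sigma>' \<in> carrier (subst_monoid v)"
  shows "index_map (\<sigma> \<otimes>\<^bsub>subst_monoid v\<^esub> \<sigma>') = index_map \<sigma> \<circ> index_map \<sigma>'"
proof
  fix i
  show "index_map (\<sigma> \<otimes>\<^bsub>subst_monoid v\<^esub> \<sigma>') i = (index_map \<sigma> \<circ> index_map \<sigma>') i"
  proof (cases "i < n")
    case True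
    then have "index_map (\<sigma> \<otimes>\<^bsub>subst_monoid v\<^esub> \<sigma>') i =
        index (\<lambda>k. holds {} (\<lambda>l. holds {} (valuation i) (\<sigma>' l)) (\<sigma> k))"
      by (simp add: index_map_def subst_monoid_def holds_lsubst)
    also have "\<dots> = index_map \<sigma> (index_map \<sigma>' i)"
      using True assms by (simp add: index_holds_subst)
    finally show ?thesis by simp
  qed (simp add: index_map_def)
qed

lemma index_map_one: "index_map \<one>\<^bsub>subst_monoid v\<^esub> = id"
  by (auto simp: index_map_def subst_monoid_def)

lemma inj_on_index_map: "inj_on index_map (carrier (subst_monoid v))"
proof (intro inj_onI ext)
  fix \<sigma> \<tau> k
  assume \<sigma>: "\<sigma> \<in> carrier (subst_monoid v)" and \<tau>: "\<tau> \<in> carrier (subst_monoid v)"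
    and eq: "index_map \<sigma> = index_map \<tau>"
  show "\<sigma> k = \<tau> k"
  proof (cases "k < v")
    case True
    then have ctx: "\<sigma> k \<in> K_ctx v 1" "\<tau> k \<in> K_ctx v 1"
      using \<sigma> \<tau> K_ctx_mono[of 0 1 v] by (auto simp: subst_monoid_def)
    show ?thesis
    proof (rule K_ctx_1_eqI[OF ctx])
      fix X g
      have "index (\<lambda>k. holds X g (\<sigma> k)) = index (\<lambda>k. holds X g (\<tau> k))"
        by (simp add: index_holds_subst \<sigma> \<tau> eq)
      then show "holds X g (\<sigma> k) = holds X g (\<tau> k)" using True by (simp add: index_eq_iff)
    qed
  qed (use \<sigma> \<tau> in \<open>simp add: subst_monoid_def\<close>)
qed

lemma subst_mult_eq_one_iff:
  assumes \<sigma>: "\<sigma> \<in> carrier (subst_monoid v)" and \<sigma>': "\<sigma>' \<in> carrier (subst_monoid v)"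
  shows "\<sigma> \<otimes>\<^bsub>subst_monoid v\<^esub> \<sigma>' = \<one>\<^bsub>subst_monoid v\<^esub> \<longleftrightarrow> index_map \<sigma> \<circ> index_map \<sigma>' = id"
proof -
  interpret monoid "subst_monoid v" by (rule subst_monoid)
  show ?thesis
    using inj_on_eq_iff[OF inj_on_index_map m_closed[OF \<sigma> \<sigma>'] one_closed]
    by (simp add: index_map_mult[OF \<sigma> \<sigma>'] index_map_one)
qed

lemma ex_index_map_eq:
  assumes f: "\<And>i. i < n \<Longrightarrow> f i < n" "\<And>i. \<not> i < n \<Longrightarrow> f i = i"
  obtains \<sigma> where "\<sigma> \<in> carrier (subst_monoid v)" "index_map \<sigma> = f"
proof -
  have "\<forall>k. \<exists>x. x \<in> K_ctx v 0 \<and> (\<forall>X g. holds X g x = valuation (f (index g)) k)"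
    using ex_truth_function[where F = "\<lambda>i. valuation (f i) _"] by (simp add: Bex_def)
  then obtain \<tau> where
    "\<forall>k. \<tau> k \<in> K_ctx v 0 \<and> (\<forall>X g. holds X g (\<tau> k) = valuation (f (index g)) k)"
    by (rule choice[THEN exE])
  then have \<tau>: "\<tau> k \<in> K_ctx v 0" "holds X g (\<tau> k) = valuation (f (index g)) k" for k X g
    by simp_all
  define \<sigma> where "\<sigma> k = (if k < v then \<tau> k else cls (Var k))" for k
  have "\<sigma> \<in> carrier (subst_monoid v)" by (simp add: subst_monoid_def \<sigma>_def \<tau>(1))
  moreover have "index_map \<sigma> i = f i" for i
  proof (cases "i < n")
    case True
    then have "index_map \<sigma> i = index (valuation (f i))"
      by (simp add: index_map_def index_eq_iff \<sigma>_def \<tau>(2))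
    then show ?thesis using f(1) True by simp
  qed (simp add: index_map_def f(2))
  ultimately show ?thesis using that by blast
qed

lemma carrier_prime_substs: "carrier (prime_substs v) = Units (subst_monoid v)"
  by (simp add: prime_substs_def units_of_def)

lemma index_map_permutes_if_prime:
  assumes "\<sigma> \<in> carrier (prime_substs v)"
  shows "index_map \<sigma> permutes {..<n}"
proof -
  obtain \<sigma>' where "\<sigma> \<in> carrier (subst_monoid v)" "\<sigma>' \<in> carrier (subst_monoid v)"
    "\<sigma>' \<otimes>\<^bsub>subst_monoid v\<^esub> \<sigma> = \<one>\<^bsub>subst_monoid v\<^esub>"
    "\<sigma> \<otimes>\<^bsub>subst_monoid v\<^esub> \<sigma>' = \<one>\<^bsub>subst_monoid v\<^esub>"
    using assms by (auto simp: carrier_prime_substs Units_def)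
  then have "index_map \<sigma>' \<circ> index_map \<sigma> = id" "index_map \<sigma> \<circ> index_map \<sigma>' = id"
    by (simp_all add: subst_mult_eq_one_iff)
  then have "bij (index_map \<sigma>)" by (rule o_bij)
  then show ?thesis by (auto simp: permutes_def bij_iff index_map_def)
qed

lemma ex_prime_subst_index_map_eq:
  assumes \<pi>: "\<pi> permutes {..<n}"
  obtains \<sigma> where "\<sigma> \<in> carrier (prime_substs v)" "index_map \<sigma> = \<pi>"
proof -
  have subst_of: "\<exists>\<sigma> \<in> carrier (subst_monoid v). index_map \<sigma> = \<rho>" if "\<rho> permutes {..<n}" for \<rho>
    using ex_index_map_eq[of \<rho>] permutes_in_image[OF that] permutes_not_in[OF that]
    by (metis lessThan_iff)
  obtain \<rho> where \<rho>: "\<rho> permutes {..<n}" "\<rho> \<circ> \<pi> = id" "\<pi> \<circ> \<rho> = id"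
    using permutes_inv[OF \<pi>] permutes_inv_o[OF \<pi>] by blast
  obtain \<sigma> \<sigma>' where \<sigma>: "\<sigma> \<in> carrier (subst_monoid v)" "index_map \<sigma> = \<pi>"
    and \<sigma>': "\<sigma>' \<in> carrier (subst_monoid v)" "index_map \<sigma>' = \<rho>"
    using subst_of[OF \<pi>] subst_of[OF \<rho>(1)] by blast
  have "\<sigma>' \<otimes>\<^bsub>subst_monoid v\<^esub> \<sigma> = \<one>\<^bsub>subst_monoid v\<^esub>" "\<sigma> \<otimes>\<^bsub>subst_monoid v\<^esub> \<sigma>' = \<one>\<^bsub>subst_monoid v\<^esub>"
    using \<sigma> \<sigma>' \<rho> by (simp_all add: subst_mult_eq_one_iff)
  then have "\<sigma> \<in> carrier (prime_substs v)"
    using \<sigma>(1) \<sigma>'(1) by (auto simp: carrier_prime_substs Units_def)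
  then show ?thesis using that \<sigma>(2) by blast
qed

text \<open>Pulling back is contravariant, so \<open>\<sigma>\<close> moves the indices by the inverse of \<open>index_map \<sigma>\<close>.\<close>

lemma lsubst_minterm_image:
  assumes \<sigma>: "\<sigma> \<in> carrier (prime_substs v)" and "s < n" "E \<subseteq> {..<n}"
  shows "lsubst \<sigma> (minterm (index_map \<sigma> s) (index_map \<sigma> ` E)) = minterm s E"
proof -
  let ?f = "index_map \<sigma>"
  have carrier: "\<sigma> \<in> carrier (subst_monoid v)"
    using \<sigma> by (auto simp: carrier_prime_substs Units_def)
  have f: "?f permutes {..<n}" using \<sigma> by (rule index_map_permutes_if_prime)
  have image: "?f s < n" "?f ` E \<subseteq> {..<n}"
    using assms(2,3) permutes_in_image[OF f] by auto
  show ?thesis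
  proof (rule K_ctx_1_eqI)
    show "lsubst \<sigma> (minterm (?f s) (?f ` E)) \<in> K_ctx v 1"
      using image by (intro lsubst_K_ctx carrier minterm_in_K_ctx)
    show "minterm s E \<in> K_ctx v 1" using assms(2) by (rule minterm_in_K_ctx)
    fix X g
    have "holds X g (lsubst \<sigma> (minterm (?f s) (?f ` E)))
        \<longleftrightarrow> ?f (index g) = ?f s \<and> ?f ` index ` X = ?f ` E"
      by (simp add: holds_lsubst holds_minterm image image_image index_holds_subst carrier)
    also have "\<dots> \<longleftrightarrow> index g = s \<and> index ` X = E"
      using permutes_inj[OF f] by (simp add: inj_eq inj_image_eq_iff)
    finally show "holds X g (lsubst \<sigma> (minterm (?f s) (?f ` E))) = holds X g (minterm s E)"
      using assms(2,3) by (simp add: holds_minterm)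
  qed
qed

section \<open>Orbits\<close>

definition orbit_class :: "bool \<times> nat \<Rightarrow> lindenbaum set" where
  "orbit_class p = {minterm s E | s E. s < n \<and> E \<subseteq> {..<n} \<and> pointed_card s E = p}"

lemma minterm_in_orbit_class_iff:
  assumes "s < n" "E \<subseteq> {..<n}"
  shows "minterm s E \<in> orbit_class p \<longleftrightarrow> pointed_card s E = p"
  using assms by (auto simp: orbit_class_def minterm_eq_iff)

lemma orbit_minterm:
  assumes "s < n" "E \<subseteq> {..<n}"
  shows "orbit (prime_substs v) lsubst (minterm s E) = orbit_class (pointed_card s E)"
proof (intro subset_antisym subsetI)
  fix x assume "x \<in> orbit (prime_substs v) lsubst (minterm s E)"
  then obtain \<sigma> where \<sigma>: "\<sigma> \<in> carrier (prime_substs v)" and x: "x = lsubst \<sigma> (minterm s E)"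
    by (auto simp: orbit_def)
  let ?f = "index_map \<sigma>"
  have f: "?f permutes {..<n}" using \<sigma> by (rule index_map_permutes_if_prime)
  obtain s' where s': "s = ?f s'" using permutes_surj[OF f] by (auto elim: surjE)
  define E' where "E' = ?f -` E"
  have E': "E = ?f ` E'" using permutes_surj[OF f] by (simp add: E'_def surj_image_vimage_eq)
  have "s' < n" "E' \<subseteq> {..<n}" using assms s' permutes_in_image[OF f] by (auto simp: E'_def)
  moreover from this have "x = minterm s' E'"
    unfolding x s' E' by (rule lsubst_minterm_image[OF \<sigma>])
  moreover have "pointed_card s' E' = pointed_card s E"
    unfolding s' E' by (rule pointed_card_image[OF permutes_inj[OF f], symmetric])
  ultimately show "x \<in> orbit_class (pointed_card s E)" by (auto simp: orbit_class_def)
next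
  fix x assume "x \<in> orbit_class (pointed_card s E)"
  then obtain s' E' where x: "x = minterm s' E'" "s' < n" "E' \<subseteq> {..<n}"
    and "pointed_card s' E' = pointed_card s E"
    by (auto simp: orbit_class_def)
  then obtain \<pi> where \<pi>: "\<pi> permutes {..<n}" "\<pi> s' = s" "\<pi> ` E' = E"
    using assms ex_permutes_pointed_iff[of "{..<n}" s' E' s E] by auto
  obtain \<sigma> where \<sigma>: "\<sigma> \<in> carrier (prime_substs v)" "index_map \<sigma> = \<pi>"
    using ex_prime_subst_index_map_eq[OF \<pi>(1)] by blast
  then have "x = lsubst \<sigma> (minterm s E)"
    using lsubst_minterm_image[OF \<sigma>(1) x(2,3)] by (simp add: \<pi>(2,3) x(1))
  then show "x \<in> orbit (prime_substs v) lsubst (minterm s E)"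
    using \<sigma>(1) by (auto simp: orbit_def)
qed

lemma section_minterms_eq: "section_minterms v m s = minterm s ` Pow {..<n}"
proof (intro subset_antisym subsetI)
  fix x assume "x \<in> section_minterms v m s"
  then obtain \<epsilon> where "x = minterm s {i. i < n \<and> \<epsilon> i}"
    by (auto simp: section_minterms_def minterm1_eq_minterm)
  then show "x \<in> minterm s ` Pow {..<n}" by (rule image_eqI) auto
qed (auto simp: section_minterms_def minterm_def)

lemma card_orbit_class_Int_section:
  assumes "s < n"
  shows "card (orbit_class (e, k) \<inter> section_minterms v m s) = (n - 1) choose k"
proof -
  have "orbit_class (e, k) \<inter> section_minterms v m s =
      minterm s ` {E. E \<subseteq> {..<n} \<and> pointed_card s E = (e, k)}"
    unfolding section_minterms_eq using assms minterm_in_orbit_class_iff by blast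
  moreover have "inj_on (minterm s) {E. E \<subseteq> {..<n} \<and> pointed_card s E = (e, k)}"
    using assms by (auto simp: inj_on_def minterm_eq_iff)
  ultimately have "card (orbit_class (e, k) \<inter> section_minterms v m s) =
      card {E. E \<subseteq> {..<n} \<and> pointed_card s E = (e, k)}"
    by (simp add: card_image)
  also have "\<dots> = (n - 1) choose k"
    using card_subsets_pointed_card[of "{..<n}" s e k] assms by simp
  finally show ?thesis .
qed

lemma orbit_class_nonempty:
  assumes "k < n"
  shows "orbit_class (e, k) \<noteq> {}"
proof -
  have "card (orbit_class (e, k) \<inter> section_minterms v m 0) \<noteq> 0"
    using assms by (subst card_orbit_class_Int_section) (auto simp: binomial_eq_0_iff)
  then show ?thesis by auto
qed

lemma pointed_card_range:
  assumes "s < n" "E \<subseteq> {..<n}"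
  shows "pointed_card s E \<in> UNIV \<times> {..<n}"
proof -
  have "E - {s} \<subset> {..<n}" using assms by auto
  then show ?thesis using psubset_card_mono[of "{..<n}" "E - {s}"] by (simp add: pointed_card_def)
qed

lemma prime_orbits_eq: "prime_orbits v 1 = orbit_class ` (UNIV \<times> {..<n})"
proof (intro subset_antisym subsetI)
  fix Q assume "Q \<in> prime_orbits v 1"
  then obtain s E where "s < n" "E \<subseteq> {..<n}" "Q = orbit (prime_substs v) lsubst (minterm s E)"
    unfolding prime_orbits_def orbits_def minterms_eq by blast
  then show "Q \<in> orbit_class ` (UNIV \<times> {..<n})"
    using pointed_card_range by (auto simp: orbit_minterm)
next
  fix Q assume "Q \<in> orbit_class ` (UNIV \<times> {..<n})"
  then obtain e k where Q: "Q = orbit_class (e, k)" "k < n" by auto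
  then obtain s E where "s < n" "E \<subseteq> {..<n}" "pointed_card s E = (e, k)"
    using orbit_class_nonempty[of k e] by (auto simp: orbit_class_def)
  then have "Q = orbit (prime_substs v) lsubst (minterm s E)" "minterm s E \<in> minterms v 1"
    unfolding minterms_eq by (auto simp: Q orbit_minterm)
  then show "Q \<in> prime_orbits v 1" unfolding prime_orbits_def orbits_def by blast
qed

lemma inj_on_orbit_class: "inj_on orbit_class (UNIV \<times> {..<n})"
proof (rule inj_onI)
  fix p q assume "p \<in> UNIV \<times> {..<n}" and eq: "orbit_class p = orbit_class q"
  then obtain x where "x \<in> orbit_class p" using orbit_class_nonempty by fastforce
  then obtain s E where bounds: "s < n" "E \<subseteq> {..<n}" "minterm s E \<in> orbit_class p"
    by (auto simp: orbit_class_def)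
  then have "minterm s E \<in> orbit_class q" using eq by simp
  then show "p = q" using bounds by (simp add: minterm_in_orbit_class_iff)
qed

lemma card_prime_orbits: "card (prime_orbits v 1) = 2 * n"
  unfolding prime_orbits_eq by (simp add: card_image[OF inj_on_orbit_class] card_cartesian_product)

lemma orbit_class_eq_minterm1:
  "orbit_class (e, k) =
    {minterm1 v m s \<epsilon> | s \<epsilon>. s < n \<and> \<epsilon> s = e \<and> card {i. i < n \<and> i \<noteq> s \<and> \<epsilon> i} = k}"
proof (intro subset_antisym subsetI)
  fix x assume "x \<in> orbit_class (e, k)"
  then obtain s E where "x = minterm1 v m s (\<lambda>i. i \<in> E)" "s < n" "(s \<in> E) = e" "card (E - {s}) = k"
    and "E \<subseteq> {..<n}"
    by (auto simp: orbit_class_def minterm_def pointed_card_def)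
  moreover from this have "{i. i < n \<and> i \<noteq> s \<and> i \<in> E} = E - {s}" by auto
  ultimately show "x \<in> {minterm1 v m s \<epsilon> | s \<epsilon>.
      s < n \<and> \<epsilon> s = e \<and> card {i. i < n \<and> i \<noteq> s \<and> \<epsilon> i} = k}"
    by (intro CollectI exI[of _ s] exI[of _ "\<lambda>i. i \<in> E"]) simp
next
  fix x assume "x \<in> {minterm1 v m s \<epsilon> | s \<epsilon>.
      s < n \<and> \<epsilon> s = e \<and> card {i. i < n \<and> i \<noteq> s \<and> \<epsilon> i} = k}"
  then obtain s \<epsilon> where x: "x = minterm1 v m s \<epsilon>"
    and \<epsilon>: "s < n" "\<epsilon> s = e" "card {i. i < n \<and> i \<noteq> s \<and> \<epsilon> i} = k"
    by blast
  define E where "E = {i. i < n \<and> \<epsilon> i}"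
  have "E - {s} = {i. i < n \<and> i \<noteq> s \<and> \<epsilon> i}" by (auto simp: E_def)
  then have "pointed_card s E = (e, k)" using \<epsilon> by (simp add: pointed_card_def E_def)
  moreover have "x = minterm s E" by (simp add: x minterm1_eq_minterm E_def)
  moreover have "E \<subseteq> {..<n}" by (auto simp: E_def)
  ultimately show "x \<in> orbit_class (e, k)" using \<epsilon>(1) by (auto simp: orbit_class_def)
qed

lemma Dc_eq: "Dc v m k = orbit_class (False, k)"
  by (simp add: Dc_def orbit_class_eq_minterm1)

lemma Dw_eq: "Dw v m k = orbit_class (True, k)"
  by (simp add: Dw_def orbit_class_eq_minterm1)

lemma Vv0_eq: "Vv0 v m = orbit_class (False, 0)"
  unfolding Vv0_def orbit_class_eq_minterm1 by auto

lemma Dd0_eq: "Dd0 v m = orbit_class (True, 0)"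
  unfolding Dd0_def orbit_class_eq_minterm1 by auto

end

theorem theorem8:
  fixes v n :: nat and m :: "nat \<Rightarrow> fm"
  assumes "v \<ge> 1" and "n = 2 ^ v" and "enumerates_bool_minterms v m"
  shows "card (prime_orbits v 1) = 2 * n
    \<and> prime_orbits v 1 = {Vv0 v m, Dd0 v m} \<union> Dc v m ` {1..<n} \<union> Dw v m ` {1..<n}
    \<and> (\<forall>k \<in> {1..<n}. \<forall>s < n.
          card (Dc v m k \<inter> section_minterms v m s) = (n - 1) choose k
        \<and> card (Dw v m k \<inter> section_minterms v m s) = (n - 1) choose k)"
proof -
  interpret bool_minterm_enumeration v m
    using assms(3) by unfold_locales
  have "{..<n} = insert 0 {1..<n}" using assms(2) by auto
  then have "orbit_class ` (UNIV \<times> {..<n}) =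
      {Vv0 v m, Dd0 v m} \<union> Dc v m ` {1..<n} \<union> Dw v m ` {1..<n}"
    unfolding Vv0_eq Dd0_eq Dc_eq[abs_def] Dw_eq[abs_def] UNIV_bool by auto
  then show ?thesis
    using card_prime_orbits prime_orbits_eq card_orbit_class_Int_section assms(2)
    by (simp add: Dc_eq Dw_eq)
qed

end
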